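(* Let $\mathcal H = (H, \preceq)$ be a loft premonoid. Then: (i) $\mathcal H$ is BF-factorable (resp., BmF-factorable) if and only if it is FF-factorable (resp., FmF-factorable). (ii) Up to $\sqsubseteq_{\mathcal H}$-equivalence, every $\preceq$-non-unit of $H$ has finitely many minimal $\preceq$-factorizations.
   Context: A premonoid is a pair $\mathcal H = (H, \preceq)$ consisting of a (multiplicatively written) monoid $H$ with identity $1_H$ and a preorder (reflexive, transitive relation) $\preceq$ on $H$; no compatibility is assumed. Write $x \prec y$ if $x \preceq y$ and $y \not\preceq x$. An element $u \in H$ is a $\preceq$-unit if $u \preceq 1_H \preceq u$ and a $\preceq$-non-unit otherwise. A $\preceq$-irreducible is a $\preceq$-non-unit $a$ such that $a \neq xy$ for all $\preceq$-non-units $x, y \in H$ with $x \prec a$ and $y \prec a$; $\mathscr I(\mathcal H)$ is the set of $\preceq$-irreducibles. For a set $X$, an $X$-word is an element of the free monoid $\mathscr F(X)$, i.e., a finite (possibly empty) tuple of elements of $X$; $\|\mathfrak a\|$ denotes the length of a word $\mathfrak a$ and $\mathfrak a[i]$ its $i$-th letter. Let $\pi_H \colon \mathscr F(H) \to H$ be the monoid homomorphism extending the identity map of $H$ (the product of the letters). Define a preorder $\sqsubseteq_{\mathcal H}$ on $\mathscr F(H)$ by: $\mathfrak a \sqsubseteq_{\mathcal H} \mathfrak b$ iff there is an injective function $\sigma \colon \{1, \ldots, \|\mathfrak a\|\} \to \{1, \ldots, \|\mathfrak b\|\}$ with $\mathfrak a[i] \preceq \mathfrak b[\sigma(i)] \preceq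 \mathfrak a[i]$ for every $i$. Words $\mathfrak a, \mathfrak b$ are $\sqsubseteq_{\mathcal H}$-equivalent if $\mathfrak a \sqsubseteq_{\mathcal H} \mathfrak b \sqsubseteq_{\mathcal H} \mathfrak a$; write $\mathfrak a \sqsubset_{\mathcal H} \mathfrak b$ if $\mathfrak a \sqsubseteq_{\mathcal H} \mathfrak b$ and not $\mathfrak b \sqsubseteq_{\mathcal H} \mathfrak a$. For $x \in H$, a $\preceq$-factorization of $x$ is a word $\mathfrak a \in \mathscr F(\mathscr I(\mathcal H))$ with $\pi_H(\mathfrak a) = x$; their set is $\mathcal Z_{\mathcal H}(x)$. A minimal $\preceq$-factorization of $x$ is an $\mathfrak a \in \mathcal Z_{\mathcal H}(x)$ such that no $\mathfrak b \in \mathcal Z_{\mathcal H}(x)$ satisfies $\mathfrak b \sqsubset_{\mathcal H} \mathfrak a$; their set is $\mathcal Z^{\mathsf m}_{\mathcal H}(x)$. Let $\mathsf L_{\mathcal H}(x)$ (resp., $\mathsf L^{\mathsf m}_{\mathcal H}(x)$) be the set of lengths of words in $\mathcal Z_{\mathcal H}(x)$ (resp., $\mathcal Z^{\mathsf m}_{\mathcal H}(x)$). $\mathcal H$ is BF-factorable (resp., BmF-factorable) if $\mathsf L_{\mathcal H}(x)$ (resp., $\mathsf L^{\mathsf m}_{\mathcal H}(x)$) is finite and non-empty for every $\preceq$-non-unit $x$; FF-factorable (resp., FmF-factorable) if the quotient of $\mathcal Z_{\mathcal H}(x)$ (resp., $\mathcal Z^{\mathsf m}_{\mathcal H}(x)$)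 by $\sqsubseteq_{\mathcal H}$-equivalence is finite and non-empty for every $\preceq$-non-unit $x$. $\mathcal H$ is loft (locally of finite type) if, for each $\preceq$-non-unit $x$, there is a finite set $A_x \subseteq \mathscr I(\mathcal H)$ such that every $\preceq$-factorization of $x$ is $\sqsubseteq_{\mathcal H}$-equivalent to an $A_x$-word. *)

theory Defs
  imports Main
begin

text \<open>
  The monoid \<open>H\<close> is an arbitrary type of class \<^class>\<open>monoid_mult\<close>, so a premonoid on it is given by
  the preorder alone. Words over \<open>H\<close> are lists, with letters indexed from \<open>0\<close>; the homomorphism
  \<open>\<pi>\<^sub>H\<close> is \<^const>\<open>prod_list\<close> and the \<open>X\<close>-words are \<open>lists X\<close>.
\<close>

definition premonoid :: "('a::monoid_mult \<Rightarrow> 'a \<Rightarrow> bool) \<Rightarrow> bool" where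
  "premonoid le \<longleftrightarrow> reflp le \<and> transp le"

context
  fixes le :: "'a::monoid_mult \<Rightarrow> 'a \<Rightarrow> bool"  (infix "\<preceq>" 50)
begin

definition pre_less :: "'a \<Rightarrow> 'a \<Rightarrow> bool"  (infix "\<prec>" 50) where
  "x \<prec> y \<longleftrightarrow> x \<preceq> y \<and> \<not> y \<preceq> x"

definition pre_unit :: "'a \<Rightarrow> bool" where
  "pre_unit u \<longleftrightarrow> u \<preceq> 1 \<and> 1 \<preceq> u"

definition irreducibles :: "'a set" where
  "irreducibles = {a. \<not> pre_unit a \<and>
     (\<forall>x y. \<not> pre_unit x \<and> \<not> pre_unit y \<and> x \<prec> a \<and> y \<prec> a \<longrightarrow> a \<noteq> x * y)}"

definition word_le :: "'a list \<Rightarrow> 'a list \<Rightarrow> bool"  (infix "\<sqsubseteq>" 50) where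
  "\<aa> \<sqsubseteq> \<bb> \<longleftrightarrow> (\<exists>\<sigma> :: nat \<Rightarrow> nat.
     inj_on \<sigma> {..<length \<aa>} \<and> \<sigma> ` {..<length \<aa>} \<subseteq> {..<length \<bb>} \<and>
     (\<forall>i<length \<aa>. \<aa> ! i \<preceq> \<bb> ! \<sigma> i \<and> \<bb> ! \<sigma> i \<preceq> \<aa> ! i))"

definition word_equiv :: "'a list \<Rightarrow> 'a list \<Rightarrow> bool" where
  "word_equiv \<aa> \<bb> \<longleftrightarrow> \<aa> \<sqsubseteq> \<bb> \<and> \<bb> \<sqsubseteq> \<aa>"

definition word_less :: "'a list \<Rightarrow> 'a list \<Rightarrow> bool"  (infix "\<sqsubset>" 50) where
  "\<aa> \<sqsubset> \<bb> \<longleftrightarrow> \<aa> \<sqsubseteq> \<bb> \<and> \<not> \<bb> \<sqsubseteq> \<aa>"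

definition factorizations :: "'a \<Rightarrow> 'a list set" where
  "factorizations x = {\<aa> \<in> lists irreducibles. prod_list \<aa> = x}"

definition min_factorizations :: "'a \<Rightarrow> 'a list set" where
  "min_factorizations x = {\<aa> \<in> factorizations x. \<not> (\<exists>\<bb> \<in> factorizations x. \<bb> \<sqsubset> \<aa>)}"

definition lengths :: "'a \<Rightarrow> nat set" where
  "lengths x = length ` factorizations x"

definition min_lengths :: "'a \<Rightarrow> nat set" where
  "min_lengths x = length ` min_factorizations x"

definition equiv_classes :: "'a list set \<Rightarrow> 'a list set set" where
  "equiv_classes Z = Z // {(\<aa>, \<bb>). \<aa> \<in> Z \<and> \<bb> \<in> Z \<and> word_equiv \<aa> \<bb>}"

definition BF_factorable :: bool where
  "BF_factorable \<longleftrightarrow> (\<forall>x. \<not> pre_unit x \<longrightarrow> finite (lengths x) \<and> lengths x \<noteq> {})"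

definition BmF_factorable :: bool where
  "BmF_factorable \<longleftrightarrow> (\<forall>x. \<not> pre_unit x \<longrightarrow> finite (min_lengths x) \<and> min_lengths x \<noteq> {})"

definition FF_factorable :: bool where
  "FF_factorable \<longleftrightarrow> (\<forall>x. \<not> pre_unit x \<longrightarrow>
     finite (equiv_classes (factorizations x)) \<and> equiv_classes (factorizations x) \<noteq> {})"

definition FmF_factorable :: bool where
  "FmF_factorable \<longleftrightarrow> (\<forall>x. \<not> pre_unit x \<longrightarrow>
     finite (equiv_classes (min_factorizations x)) \<and> equiv_classes (min_factorizations x) \<noteq> {})"

definition loft :: bool where
  "loft \<longleftrightarrow> (\<forall>x. \<not> pre_unit x \<longrightarrow>
     (\<exists>A. finite A \<and> A \<subseteq> irreducibles \<and>
       (\<forall>\<aa> \<in> factorizations x. \<exists>\<bb> \<in> lists A. word_equiv \<aa> \<bb>)))"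

end

end

theory Submission
  imports Defs "HOL-Library.Infinite_Set" "HOL-Combinatorics.List_Permutation"
begin

text \<open>
  Over a finite alphabet \<open>A\<close>, a word is determined up to equivalence by its multiset of letters,
  and multiset inclusion implies \<open>\<sqsubseteq>\<close>. Minimal factorizations that are pairwise non-equivalent thus
  yield an antichain of multisets over \<open>A\<close>, which is finite by Dickson's lemma. For arbitrary
  factorizations, equivalent words have the same length, and there are only finitely many
  \<open>A\<close>-words of each length.
\<close>

text \<open>Every tail of a sequence of naturals attains its minimum, so infinitely many indices lie
  in \<open>?S\<close>: those whose value is least from there on. Enumerating \<open>?S\<close>
  increasingly gives the subsequence.\<close>

lemma nondecreasing_subseq:
  fixes g :: "nat \<Rightarrow> nat"
  shows "\<exists>s :: nat \<Rightarrow> nat. strict_mono s \<and> mono (g \<circ> s)"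
proof -
  let ?S = "{i. \<forall>j\<ge>i. g i \<le> g j}"
  have "infinite ?S"
    unfolding infinite_nat_iff_unbounded_le
  proof
    fix m
    obtain i where "m \<le> i" "\<forall>j. m \<le> j \<longrightarrow> g i \<le> g j"
      using ex_has_least_nat[of "\<lambda>i. m \<le> i" m g] by auto
    then show "\<exists>n\<ge>m. n \<in> ?S" by (intro exI[of _ i]) auto
  qed
  then obtain s :: "nat \<Rightarrow> nat" where s: "strict_mono s" "\<And>n. s n \<in> ?S"
    using infinite_enumerate by blast
  then have "mono (g \<circ> s)"
    by (auto intro!: monoI simp: strict_mono_less_eq)
  with s show ?thesis by blast
qed

text \<open>This is the refinement argument behind Dickson's lemma: one thinning per letter.
  Thinning again for a new letter keeps the counts of the earlier letters monotone.\<close>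

lemma multiset_nondecreasing_subseq:
  fixes M :: "nat \<Rightarrow> 'a multiset"
  assumes "finite A"
  shows "\<exists>s :: nat \<Rightarrow> nat. strict_mono s \<and> (\<forall>a\<in>A. mono (\<lambda>i. count (M (s i)) a))"
  using assms
proof (induction A)
  case empty
  show ?case by (intro exI[of _ id]) (simp add: strict_mono_def)
next
  case (insert a A)
  then obtain s :: "nat \<Rightarrow> nat"
    where s: "strict_mono s" "\<forall>a\<in>A. mono (\<lambda>i. count (M (s i)) a)" by auto
  obtain t :: "nat \<Rightarrow> nat" where t: "strict_mono t" "mono ((\<lambda>i. count (M (s i)) a) \<circ> t)"
    using nondecreasing_subseq[of "\<lambda>i. count (M (s i)) a"] by auto
  have "strict_mono (s \<circ> t)" using s t by (simp add: strict_mono_def)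
  moreover have "mono (\<lambda>i. count (M ((s \<circ> t) i)) b)" if "b \<in> insert a A" for b
    using that s t strict_mono_mono[OF t(1)] by (auto simp: mono_def)
  ultimately show ?case by (intro exI[of _ "s \<circ> t"] conjI ballI)
qed

text \<open>An infinite \<open>S\<close> would contain an injective sequence. After thinning it as
  above, its first two terms are comparable: counts in \<open>A\<close> do not decrease, and letters
  outside \<open>A\<close> never occur. The antichain condition then makes them equal, against
  injectivity.\<close>

lemma finite_multiset_antichain:
  assumes "finite A"
    and "\<And>M. M \<in> S \<Longrightarrow> set_mset M \<subseteq> A"
    and "\<And>M N. M \<in> S \<Longrightarrow> N \<in> S \<Longrightarrow> M \<subseteq># N \<Longrightarrow> M = N"
  shows "finite S"
proof (rule ccontr)
  assume "infinite S"
  then obtain f :: "nat \<Rightarrow> 'a multiset" where f: "inj f" "range f \<subseteq> S"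
    using infinite_countable_subset by blast
  obtain s :: "nat \<Rightarrow> nat"
    where s: "strict_mono s" "\<forall>a\<in>A. mono (\<lambda>i. count (f (s i)) a)"
    using multiset_nondecreasing_subseq[OF assms(1)] by blast
  have "count (f (s 0)) a \<le> count (f (s 1)) a" for a
  proof (cases "a \<in> A")
    case True
    then show ?thesis using s(2) by (auto dest: monoD)
  next
    case False
    then have "a \<notin># f (s 0)" using assms(2) f(2) by blast
    then show ?thesis by (simp add: not_in_iff)
  qed
  then have "f (s 0) \<subseteq># f (s 1)" by (simp add: subseteq_mset_def)
  then have "f (s 0) = f (s 1)" using assms(3) f(2) by blast
  then have "s 0 = s 1" using f(1) by (simp add: inj_eq)
  then show False using strict_monoD[OF s(1), of 0 1] by simp
qed

lemma word_le_trans: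
  assumes "premonoid le" "word_le le u v" "word_le le v w"
  shows "word_le le u w"
proof -
  have tr: "\<And>x y z. le x y \<Longrightarrow> le y z \<Longrightarrow> le x z"
    using assms(1) unfolding premonoid_def by (auto dest: transpD)
  obtain f where f: "inj_on f {..<length u}" "f ` {..<length u} \<subseteq> {..<length v}"
      "\<And>i. i < length u \<Longrightarrow> le (u ! i) (v ! f i) \<and> le (v ! f i) (u ! i)"
    using assms(2) unfolding word_le_def by blast
  obtain g where g: "inj_on g {..<length v}" "g ` {..<length v} \<subseteq> {..<length w}"
      "\<And>i. i < length v \<Longrightarrow> le (v ! i) (w ! g i) \<and> le (w ! g i) (v ! i)"
    using assms(3) unfolding word_le_def by blast
  show ?thesis
    unfolding word_le_def
  proof (intro exI[of _ "g \<circ> f"] conjI allI impI)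
    show "inj_on (g \<circ> f) {..<length u}"
      using f(1,2) g(1) by (simp add: comp_inj_on inj_on_subset)
    show "(g \<circ> f) ` {..<length u} \<subseteq> {..<length w}"
      using f(2) g(2) by (auto simp: image_subset_iff)
  next
    fix i assume i: "i < length u"
    then have "f i < length v" using f(2) by auto
    then show "le (u ! i) (w ! (g \<circ> f) i)" "le (w ! (g \<circ> f) i) (u ! i)"
      using f(3)[OF i] g(3)[of "f i"] tr by auto
  qed
qed

text \<open>Appending the missing letters \<open>w\<close> turns \<open>u\<close> into a permutation
  of \<open>v\<close>. The index bijection of that permutation, restricted to the positions of
  \<open>u\<close>, is the required injection; matched letters are equal, so reflexivity of
  \<open>le\<close> finishes.\<close>

lemma mset_subset_imp_word_le:
  assumes "premonoid le" "mset u \<subseteq># mset v"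
  shows "word_le le u v"
proof -
  have rf: "\<And>x. le x x"
    using assms(1) unfolding premonoid_def by (auto dest: reflpD)
  obtain w where "mset w = mset v - mset u" using ex_mset by blast
  then have "mset (u @ w) = mset v" using assms(2) by simp
  then obtain f where f: "bij_betw f {..<length (u @ w)} {..<length v}"
      "\<forall>i<length (u @ w). (u @ w) ! i = v ! f i"
    using permutation_Ex_bij by blast
  have "inj_on f {..<length u}"
    using f(1) by (auto simp: bij_betw_def inj_on_def)
  moreover have "f ` {..<length u} \<subseteq> {..<length v}"
    using f(1) by (auto simp: bij_betw_def)
  moreover have "u ! i = v ! f i" if "i < length u" for i
    using f(2)[rule_format, of i] that by (simp add: nth_append)
  ultimately show ?thesis
    unfolding word_le_def using rf by (intro exI[of _ f]) simp
qed

lemma word_equiv_trans: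
  "premonoid le \<Longrightarrow> word_equiv le u v \<Longrightarrow> word_equiv le v w \<Longrightarrow> word_equiv le u w"
  unfolding word_equiv_def using word_le_trans by blast

lemma word_equiv_sym: "word_equiv le u v \<Longrightarrow> word_equiv le v u"
  by (simp add: word_equiv_def)

lemma word_equiv_refl: "premonoid le \<Longrightarrow> word_equiv le u u"
  by (simp add: word_equiv_def mset_subset_imp_word_le)

lemma word_le_length: "word_le le u v \<Longrightarrow> length u \<le> length v"
  unfolding word_le_def using card_inj_on_le[of _ "{..<length u}" "{..<length v}"] by auto

lemma word_equiv_length: "word_equiv le u v \<Longrightarrow> length u = length v"
  unfolding word_equiv_def using word_le_length by (metis le_antisym)

lemma equiv_classes_empty_iff: "equiv_classes le Z = {} \<longleftrightarrow> Z = {}"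
  by (simp add: equiv_classes_def)

lemma equiv_classes_image:
  "equiv_classes le Z = (\<lambda>u. {v \<in> Z. word_equiv le u v}) ` Z"
  unfolding equiv_classes_def quotient_def by auto

text \<open>The class of a word is determined by its value under \<open>g\<close>, so there are at
  most as many classes as values. Both finiteness criteria below are obtained by choosing a suitable
  \<open>g\<close>.\<close>

lemma finite_equiv_classes_invariant:
  assumes "premonoid le" "finite (g ` Z)"
    and "\<And>u v. u \<in> Z \<Longrightarrow> v \<in> Z \<Longrightarrow> g u = g v \<Longrightarrow> word_equiv le u v"
  shows "finite (equiv_classes le Z)"
proof -
  let ?C = "\<lambda>u. {v \<in> Z. word_equiv le u v}"
  \<comment> \<open>\<open>inv_into Z g\<close> picks a representative in \<open>Z\<close> for each
    value of \<open>g\<close>, which recovers the class from the value alone.\<close>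
  have "?C u = ?C (inv_into Z g (g u))" if "u \<in> Z" for u
  proof -
    have "word_equiv le u (inv_into Z g (g u))"
      using that by (intro assms(3)) (auto simp: inv_into_into f_inv_into_f)
    then show ?thesis
      using word_equiv_trans[OF assms(1)] word_equiv_sym by blast
  qed
  then have "equiv_classes le Z \<subseteq> (\<lambda>y. ?C (inv_into Z g y)) ` g ` Z"
    unfolding equiv_classes_image by blast
  then show ?thesis using assms(2) finite_surj by blast
qed

text \<open>Length is constant on each class, so it can be read off from an arbitrarily chosen
  member.\<close>

lemma finite_lengths_if_finite_equiv_classes:
  assumes "premonoid le" "finite (equiv_classes le Z)"
  shows "finite (length ` Z)"
proof -
  have "length u \<in> (\<lambda>C. length (SOME v. v \<in> C)) ` equiv_classes le Z" if "u \<in> Z" for u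
  proof -
    let ?C = "{v \<in> Z. word_equiv le u v}"
    have "u \<in> ?C" using that word_equiv_refl[OF assms(1)] by simp
    then have "(SOME v. v \<in> ?C) \<in> ?C" by (rule someI)
    then have "length u = length (SOME v. v \<in> ?C)"
      using word_equiv_length by blast
    then show ?thesis unfolding equiv_classes_image using that by blast
  qed
  then show ?thesis using assms(2) by (meson finite_surj image_subsetI)
qed

text \<open>The invariant sends a word to a chosen equivalent \<open>A\<close>-word. This preserves
  length, so its values are \<open>A\<close>-words of bounded length.\<close>

lemma finite_equiv_classes_if_finite_lengths:
  assumes "premonoid le" "finite A" "finite (length ` Z)"
    and "\<And>u. u \<in> Z \<Longrightarrow> \<exists>v \<in> lists A. word_equiv le u v"
  shows "finite (equiv_classes le Z)"
proof -
  obtain f where f: "\<And>u. u \<in> Z \<Longrightarrow> f u \<in> lists A \<and> word_equiv le u (f u)"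
    using assms(4) by metis
  obtain n where "\<forall>u \<in> Z. length u \<le> n"
    using assms(3) by (auto simp: finite_nat_set_iff_bounded_le)
  then have "f ` Z \<subseteq> {v. set v \<subseteq> A \<and> length v \<le> n}"
    using f word_equiv_length by (fastforce simp: in_lists_conv_set)
  then have "finite (f ` Z)"
    using finite_lists_length_le[OF assms(2)] finite_subset by blast
  then show ?thesis
    using finite_equiv_classes_invariant[OF assms(1)]
      word_equiv_trans[OF assms(1)] word_equiv_sym f by metis
qed

text \<open>Here the invariant is the multiset of letters of a chosen equivalent
  \<open>A\<close>-word. The last hypothesis says that comparable words of \<open>Z\<close> are
  equivalent, which makes these multisets an antichain.\<close>

lemma finite_equiv_classes_antichain:
  assumes "premonoid le" "finite A"
    and "\<And>u. u \<in> Z \<Longrightarrow> \<exists>v \<in> lists A. word_equiv le u v"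
    and "\<And>u v. u \<in> Z \<Longrightarrow> v \<in> Z \<Longrightarrow> word_le le u v \<Longrightarrow> word_le le v u"
  shows "finite (equiv_classes le Z)"
proof -
  obtain f where f: "\<And>u. u \<in> Z \<Longrightarrow> f u \<in> lists A \<and> word_equiv le u (f u)"
    using assms(3) by metis
  have le: "word_le le u v" if "u \<in> Z" "v \<in> Z" "mset (f u) \<subseteq># mset (f v)" for u v
    using mset_subset_imp_word_le[OF assms(1) that(3)] f[OF that(1)] f[OF that(2)]
      word_le_trans[OF assms(1)] unfolding word_equiv_def by blast
  have "finite ((mset \<circ> f) ` Z)"
  proof (rule finite_multiset_antichain[OF assms(2)])
    fix M assume "M \<in> (mset \<circ> f) ` Z"
    then show "set_mset M \<subseteq> A" using f by fastforce
  next
    fix M N assume MN: "M \<in> (mset \<circ> f) ` Z" "N \<in> (mset \<circ> f) ` Z" "M \<subseteq># N"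
    then obtain u v where uv: "u \<in> Z" "v \<in> Z" "M = mset (f u)" "N = mset (f v)" by auto
    then have "word_le le u v" using le MN(3) by blast
    then have "word_equiv le u v" using assms(4) uv unfolding word_equiv_def by blast
    then have "length (f u) = length (f v)"
      using f uv(1,2) word_equiv_length by metis
    \<comment> \<open>A proper inclusion of multisets would make the sizes, hence the lengths of the
      two words, differ.\<close>
    then show "M = N"
      using MN(3) uv(3,4) by (metis mset_subset_size nless_le size_mset subset_mset.le_less)
  qed
  moreover have "word_equiv le u v" if "u \<in> Z" "v \<in> Z" "(mset \<circ> f) u = (mset \<circ> f) v" for u v
    using le[of u v] le[of v u] that unfolding word_equiv_def by simp
  ultimately show ?thesis by (rule finite_equiv_classes_invariant[OF assms(1)])
qed

theorem theorem4p11: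
  fixes le :: "'a::monoid_mult \<Rightarrow> 'a \<Rightarrow> bool"
  assumes "premonoid le" and "loft le"
  shows "(BF_factorable le \<longleftrightarrow> FF_factorable le) \<and>
         (BmF_factorable le \<longleftrightarrow> FmF_factorable le) \<and>
         (\<forall>x. \<not> pre_unit le x \<longrightarrow> finite (equiv_classes le (min_factorizations le x)))"
proof -
  have BF: "finite (lengths le x) \<longleftrightarrow> finite (equiv_classes le (factorizations le x))"
    and min: "finite (equiv_classes le (min_factorizations le x))"
    if x: "\<not> pre_unit le x" for x
  proof -
    obtain A where "finite A \<and> A \<subseteq> irreducibles le \<and>
        (\<forall>u \<in> factorizations le x. \<exists>v \<in> lists A. word_equiv le u v)"
      using assms(2)[unfolded loft_def, rule_format, OF x] by (rule exE)
    then have A: "finite A"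
        "\<And>u. u \<in> factorizations le x \<Longrightarrow> \<exists>v \<in> lists A. word_equiv le u v"
      by simp_all
    show "finite (lengths le x) \<longleftrightarrow> finite (equiv_classes le (factorizations le x))"
      unfolding lengths_def
      using finite_equiv_classes_if_finite_lengths[OF assms(1) A(1) _ A(2)]
        finite_lengths_if_finite_equiv_classes[OF assms(1)] by blast
    show "finite (equiv_classes le (min_factorizations le x))"
      \<comment> \<open>If \<open>u\<close> is below a minimal \<open>v\<close> but \<open>v\<close>
        is not below \<open>u\<close>, then \<open>u\<close> is a factorization strictly below
        \<open>v\<close>, contradicting minimality.\<close>
      by (rule finite_equiv_classes_antichain[OF assms(1) A(1)])
        (auto simp: min_factorizations_def word_less_def intro: A(2))
  qed
  \<comment> \<open>Both finiteness conditions on minimal factorizations thus always hold, so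
    \<open>BmF_factorable\<close> and \<open>FmF_factorable\<close> each reduce to the existence of
    a minimal factorization of every non-unit.\<close>
  have "finite (min_lengths le x)" if "\<not> pre_unit le x" for x
    unfolding min_lengths_def
    using finite_lengths_if_finite_equiv_classes[OF assms(1) min[OF that]] .
  then show ?thesis
    unfolding BF_factorable_def FF_factorable_def BmF_factorable_def FmF_factorable_def
    using BF min by (auto simp: equiv_classes_empty_iff lengths_def min_lengths_def)
qed

end
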